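(* Let $1<\delta<\gamma$ and consider the Double Hofbauer model at $\beta=1$ with normalized Jacobian $J$. Let $[0]=\{x\in\Omega: x_0=0\}$. Then $$\lim_{q\to\infty}\mu_q^{0^\infty}([0])=1\qquad\text{and}\qquad\lim_{q\to\infty}\mu_q^{1^\infty}([0])=0.$$
   Context: $\Omega=\{0,1\}^{\mathbb N}$ with the left shift $\sigma$. For $n\ge1$, $L_n\subset\Omega$ is the set of sequences beginning with exactly $n$ zeros followed by a $1$, and $R_n$ the set of sequences beginning with exactly $n$ ones followed by a $0$; $\zeta$ is the Riemann zeta function. The Double Hofbauer potential with parameters $1<\delta<\gamma$ is $g=-\gamma\log\frac{n}{n-1}$ on $L_n$ and $g=-\delta\log\frac n{n-1}$ on $R_n$ for $n\ge2$, $g=-\log\zeta(\gamma)$ on $L_1$, $g=-\log\zeta(\delta)$ on $R_1$, $g(0^\infty)=g(1^\infty)=0$. Put $r(q)=1+q^{\gamma}\sum_{n\ge2}(n+q-1)^{-\gamma}$ and $s(q)=1+q^{\delta}\sum_{n\ge2}(n+q-1)^{-\delta}$ for $q\ge1$ (these are, up to a common constant, the values on $L_q$, respectively $R_q$, of the eigenfunction $\varphi_1$, $\mathcal L_g\varphi_1=\varphi_1$). The normalized Jacobian $J$ ($\log J=g+\log\varphi_1-\log(\varphi_1\circ\sigma)$, extended to the exceptional points) is given by: $J(x)=\left(\frac{q}{q-1}\right)^{-\gamma}\frac{r(q)}{r(q-1)}$ for $x\in L_q$, $q\ge2$; $J(x)=\left(\frac{q}{q-1}\right)^{-\delta}\frac{s(q)}{s(q-1)}$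 for $x\in R_q$, $q\ge2$; $J(x)=1/s(q)$ if $x=01^q0\ldots$, $q\ge1$; $J(x)=1/r(q)$ if $x=10^q1\ldots$, $q\ge1$; $J(0^\infty)=J(1^\infty)=1$; $J(10^\infty)=J(01^\infty)=0$. Let $\mathcal L_{\log J}(\psi)(x)=\sum_{\sigma(y)=x}J(y)\psi(y)$. For $y\in\Omega$, $q\in\mathbb N$ and Borel $F\subset\Omega$, the finite volume Gibbs measure with boundary condition $y$ is $\mu_q^y(F)=\mathcal L_{\log J}^q(1_F)(\sigma^q(y))$ (the normalizing factor $\mathcal L^q_{\log J}(1)$ equals $1$). *)

theory Defs
  imports "HOL-Analysis.Analysis"
begin

text \<open>Points of \<open>{0,1}\<^sup>\<nat>\<close> are functions \<open>nat \<Rightarrow> bool\<close>; the symbol 0 is \<open>False\<close>, the symbol 1 is \<open>True\<close>.\<close>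

type_synonym omega = "nat \<Rightarrow> bool"

definition shift :: "omega \<Rightarrow> omega" where
  "shift x = (\<lambda>n. x (Suc n))"

abbreviation zeros :: omega where "zeros \<equiv> (\<lambda>_. False)"

abbreviation ones :: omega where "ones \<equiv> (\<lambda>_. True)"

definition Lset :: "nat \<Rightarrow> omega set" where
  "Lset n = {x. (\<forall>i<n. \<not> x i) \<and> x n}"

definition Rset :: "nat \<Rightarrow> omega set" where
  "Rset n = {x. (\<forall>i<n. x i) \<and> \<not> x n}"

text \<open>The length of the initial constant block; meaningful only for nonconstant \<open>x\<close>.\<close>

definition block :: "omega \<Rightarrow> nat" where
  "block x = (LEAST n. x n \<noteq> x 0)"

text \<open>The Riemann zeta function on \<open>(1, \<infinity>)\<close>.\<close>

definition zeta_real :: "real \<Rightarrow> real" where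
  "zeta_real a = (\<Sum>\<^sub>\<infinity>n\<in>{1..}. real n powr (- a))"

text \<open>The Double Hofbauer potential \<open>g\<close>.\<close>

definition hofbauer :: "real \<Rightarrow> real \<Rightarrow> omega \<Rightarrow> real" where
  "hofbauer \<gamma> \<delta> x =
    (if x = zeros \<or> x = ones then 0
     else let n = block x; a = (if x 0 then \<delta> else \<gamma>) in
       if n \<ge> 2 then - a * ln (real n / (real n - 1)) else - ln (zeta_real a))"

text \<open>\<open>eig \<gamma>\<close> is the function \<open>r\<close> and \<open>eig \<delta>\<close> is the function \<open>s\<close>: the values of the
  eigenfunction on \<open>Lset q\<close> and \<open>Rset q\<close> respectively.\<close>

definition eig :: "real \<Rightarrow> nat \<Rightarrow> real" where
  "eig a q = 1 + real q powr a * (\<Sum>\<^sub>\<infinity>n\<in>{2..}. (real n + real q - 1) powr (- a))"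

text \<open>The case distinction below is spelled out in terms of \<open>Lset\<close> and \<open>Rset\<close> in the lemmas
  \<open>jacobian_Lset\<close> to \<open>jacobian_exceptional\<close>.\<close>

definition jacobian :: "real \<Rightarrow> real \<Rightarrow> omega \<Rightarrow> real" where
  "jacobian \<gamma> \<delta> x =
    (if x = zeros \<or> x = ones then 1
     else if x = case_nat True zeros \<or> x = case_nat False ones then 0
     else let q = block x; a = (if x 0 then \<delta> else \<gamma>) in
       if q \<ge> 2 then (real q / (real q - 1)) powr (- a) * (eig a q / eig a (q - 1))
       else 1 / eig (if x 0 then \<gamma> else \<delta>) (block (shift x)))"

text \<open>The transfer operator with weight \<open>J\<close> (so \<open>J = exp \<circ> f\<close> for a real potential \<open>f\<close>). The weight
  itself is the parameter because the Jacobian vanishes at two points.\<close>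

definition transfer :: "(omega \<Rightarrow> real) \<Rightarrow> (omega \<Rightarrow> real) \<Rightarrow> omega \<Rightarrow> real" where
  "transfer J \<psi> x = (\<Sum>y\<in>{y. shift y = x}. J y * \<psi> y)"

definition gibbs :: "real \<Rightarrow> real \<Rightarrow> nat \<Rightarrow> omega \<Rightarrow> omega set \<Rightarrow> real" where
  "gibbs \<gamma> \<delta> q y F = ((transfer (jacobian \<gamma> \<delta>)) ^^ q) (indicator F) ((shift ^^ q) y)"


lemma block_Lset: "x \<in> Lset q \<Longrightarrow> q \<ge> 1 \<Longrightarrow> block x = q"
  unfolding block_def Lset_def
  by (rule Least_equality) (auto simp: not_less[symmetric])

lemma block_Rset: "x \<in> Rset q \<Longrightarrow> q \<ge> 1 \<Longrightarrow> block x = q"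
  unfolding block_def Rset_def
  by (rule Least_equality) (auto simp: not_less[symmetric])

lemma jacobian_Lset:
  assumes "x \<in> Lset q" "q \<ge> 2"
  shows "jacobian \<gamma> \<delta> x = (real q / (real q - 1)) powr (- \<gamma>) * (eig \<gamma> q / eig \<gamma> (q - 1))"
proof -
  have x: "\<not> x 0" "\<not> x 1" "x q" using assms by (auto simp: Lset_def)
  have "x \<noteq> zeros" "x \<noteq> ones" "x \<noteq> case_nat True zeros" "x \<noteq> case_nat False ones"
    using x by auto
  then show ?thesis using x assms block_Lset[OF assms(1)] by (simp add: jacobian_def Let_def)
qed

lemma jacobian_Rset:
  assumes "x \<in> Rset q" "q \<ge> 2"
  shows "jacobian \<gamma> \<delta> x = (real q / (real q - 1)) powr (- \<delta>) * (eig \<delta> q / eig \<delta> (q - 1))"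
proof -
  have x: "x 0" "x 1" "\<not> x q" using assms by (auto simp: Rset_def)
  have "x \<noteq> zeros" "x \<noteq> ones" "x \<noteq> case_nat True zeros" "x \<noteq> case_nat False ones"
    using x by auto
  then show ?thesis using x assms block_Rset[OF assms(1)] by (simp add: jacobian_def Let_def)
qed

lemma jacobian_01:
  assumes "\<not> x 0" "shift x \<in> Rset q" "q \<ge> 1"
  shows "jacobian \<gamma> \<delta> x = 1 / eig \<delta> q"
proof -
  have x: "x 1" "\<not> x (Suc q)" using assms by (auto simp: Rset_def shift_def)
  have ne: "x \<noteq> zeros" "x \<noteq> ones" "x \<noteq> case_nat True zeros" "x \<noteq> case_nat False ones"
    using x assms(1) by auto
  have "block x = 1" using x assms(1) by (intro block_Lset) (auto simp: Lset_def)
  then show ?thesis using ne assms block_Rset[OF assms(2)] by (simp add: jacobian_def Let_def)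
qed

lemma jacobian_10:
  assumes "x 0" "shift x \<in> Lset q" "q \<ge> 1"
  shows "jacobian \<gamma> \<delta> x = 1 / eig \<gamma> q"
proof -
  have x: "\<not> x 1" "x (Suc q)" using assms by (auto simp: Lset_def shift_def)
  have ne: "x \<noteq> zeros" "x \<noteq> ones" "x \<noteq> case_nat True zeros" "x \<noteq> case_nat False ones"
    using x assms(1) by auto
  have "block x = 1" using x assms(1) by (intro block_Rset) (auto simp: Rset_def)
  then show ?thesis using ne assms block_Lset[OF assms(2)] by (simp add: jacobian_def Let_def)
qed

lemma jacobian_exceptional:
  "jacobian \<gamma> \<delta> zeros = 1" "jacobian \<gamma> \<delta> ones = 1"
  "jacobian \<gamma> \<delta> (case_nat True zeros) = 0" "jacobian \<gamma> \<delta> (case_nat False ones) = 0"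
proof -
  have "case_nat True zeros \<noteq> zeros" "case_nat False ones \<noteq> zeros"
       "case_nat True zeros \<noteq> ones" "case_nat False ones \<noteq> ones"
    by (auto simp: fun_eq_iff split: nat.splits)
  then show "jacobian \<gamma> \<delta> zeros = 1" "jacobian \<gamma> \<delta> ones = 1"
    "jacobian \<gamma> \<delta> (case_nat True zeros) = 0" "jacobian \<gamma> \<delta> (case_nat False ones) = 0"
    by (simp_all add: jacobian_def)
qed


text \<open>Off the exceptional points, the Jacobian is \<open>g\<close> plus the coboundary of the logarithm of
  the eigenfunction, and it is normalized: \<open>transfer J 1 = 1\<close> everywhere.\<close>

definition eigfun :: "real \<Rightarrow> real \<Rightarrow> omega \<Rightarrow> real" where
  "eigfun \<gamma> \<delta> x = eig (if x 0 then \<delta> else \<gamma>) (block x)"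

lemma powr_summable_on: "a > 1 \<Longrightarrow> (\<lambda>n. real n powr (- a)) summable_on A"
proof -
  assume "a > 1"
  then have "summable (\<lambda>n. norm (real n powr (- a)))"
    by (simp add: summable_real_powr_iff)
  then have "(\<lambda>n. real n powr (- a)) summable_on UNIV"
    by (rule norm_summable_imp_summable_on)
  then show ?thesis by (rule summable_on_subset_banach) auto
qed

lemma powr_tail_Suc:
  assumes "a > 1"
  shows "(\<Sum>\<^sub>\<infinity>n\<in>{q..}. real n powr (- a)) =
    real q powr (- a) + (\<Sum>\<^sub>\<infinity>n\<in>{Suc q..}. real n powr (- a))"
proof -
  have "{q..} = insert q {Suc q..}" by auto
  then show ?thesis using infsum_insert[OF powr_summable_on[OF assms], of q "{Suc q..}"] by simp
qed

lemma eig_tail: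
  assumes "a > 1" "q \<ge> 1"
  shows "eig a q = real q powr a * (\<Sum>\<^sub>\<infinity>n\<in>{q..}. real n powr (- a))"
proof -
  have bij: "bij_betw (\<lambda>n. n + q - 1) {2..} {Suc q..}"
    by (rule bij_betw_byWitness[where f' = "\<lambda>n. n + 1 - q"]) (use assms(2) in auto)
  have "(\<Sum>\<^sub>\<infinity>n\<in>{2..}. (real n + real q - 1) powr (- a))
      = (\<Sum>\<^sub>\<infinity>n\<in>{2..}. real (n + q - 1) powr (- a))"
    by (rule infsum_cong) (use assms(2) in \<open>simp add: of_nat_diff\<close>)
  also have "\<dots> = (\<Sum>\<^sub>\<infinity>n\<in>{Suc q..}. real n powr (- a))"
    using infsum_reindex_bij_betw[OF bij, of "\<lambda>n. real n powr (- a)"] by simp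
  finally have *: "eig a q = 1 + real q powr a * (\<Sum>\<^sub>\<infinity>n\<in>{Suc q..}. real n powr (- a))"
    by (simp add: eig_def)
  have "real q powr a * real q powr (- a) = 1"
    using assms(2) by (simp flip: powr_add)
  then show ?thesis
    unfolding * powr_tail_Suc[OF assms(1), of q] distrib_left by simp
qed

lemma eig_pos: "eig a q > 0"
proof -
  have "(\<Sum>\<^sub>\<infinity>n\<in>{2..}. (real n + real q - 1) powr (- a)) \<ge> 0"
    by (rule infsum_nonneg) simp
  then show ?thesis by (simp add: eig_def add_pos_nonneg)
qed

lemma eig_1: "a > 1 \<Longrightarrow> eig a 1 = zeta_real a"
  by (simp add: eig_tail zeta_real_def)

lemma eig_sum:
  assumes "a > 1" "q \<ge> 1"
  shows "(real (Suc q) / (real (Suc q) - 1)) powr (- a) * (eig a (Suc q) / eig a q)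
    + 1 / eig a q = 1"
proof -
  define T where "T = (\<Sum>\<^sub>\<infinity>n\<in>{Suc q..}. real n powr (- a))"
  have q: "eig a q = real q powr a * (real q powr (- a) + T)"
    using assms by (simp add: eig_tail powr_tail_Suc[of a q] T_def)
  have q': "eig a (Suc q) = real (Suc q) powr a * T"
    using assms by (simp add: eig_tail T_def)
  have "(real (Suc q) / (real (Suc q) - 1)) powr (- a) * eig a (Suc q) + 1 = eig a q"
    using assms by (simp add: q q' powr_divide powr_minus field_simps)
  then show ?thesis using eig_pos[of a q] by (simp add: field_simps)
qed

lemma shift_preimages: "{y. shift y = x} = {case_nat False x, case_nat True x}"
proof -
  have "y = case_nat (y 0) (shift y)" for y
    by (auto simp: shift_def fun_eq_iff split: nat.splits)
  moreover have "shift (case_nat b x) = x" for b by (simp add: shift_def)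
  ultimately show ?thesis by (smt (verit) Collect_cong empty_iff insert_iff insert_compr mem_Collect_eq)
qed

lemma transfer_eq:
  "transfer J \<psi> x = J (case_nat False x) * \<psi> (case_nat False x) + J (case_nat True x) * \<psi> (case_nat True x)"
proof -
  have "case_nat False x \<noteq> case_nat True x" by (metis nat.case(1))
  then show ?thesis by (simp add: transfer_def shift_preimages)
qed

lemma omega_cases:
  obtains "x = zeros" | "x = ones" | q where "q \<ge> 1" "x \<in> Lset q" | q where "q \<ge> 1" "x \<in> Rset q"
proof (cases "\<exists>n. x n \<noteq> x 0")
  case True
  define q where "q = (LEAST n. x n \<noteq> x 0)"
  have q: "x q \<noteq> x 0" unfolding q_def using True by (rule LeastI_ex)
  have lt: "x i = x 0" if "i < q" for i using not_less_Least that unfolding q_def by blast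
  have "q \<ge> 1" using q by (cases q) auto
  then show ?thesis using q lt that(3)[of q] that(4)[of q] by (cases "x 0") (auto simp: Lset_def Rset_def)
next
  case False
  then show ?thesis using that(1,2) by (cases "x 0") (auto simp: fun_eq_iff)
qed

lemma shift_case_nat [simp]: "shift (case_nat b x) = x"
  by (simp add: shift_def)

lemma transfer_jacobian_one:
  assumes "1 < \<delta>" "\<delta> < \<gamma>"
  shows "transfer (jacobian \<gamma> \<delta>) (\<lambda>_. 1) x = 1"
proof (cases x rule: omega_cases)
  case 1
  have "case_nat False zeros = zeros" by (auto simp: fun_eq_iff split: nat.splits)
  then show ?thesis using 1 by (simp add: transfer_eq jacobian_exceptional)
next
  case 2
  have "case_nat True ones = ones" by (auto simp: fun_eq_iff split: nat.splits)
  then show ?thesis using 2 by (simp add: transfer_eq jacobian_exceptional)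
next
  case (3 q)
  have "case_nat False x \<in> Lset (Suc q)" using 3 by (auto simp: Lset_def less_Suc_eq_0_disj)
  then show ?thesis
    using 3 assms eig_sum[of \<gamma> q] jacobian_Lset[of "case_nat False x" "Suc q"]
      jacobian_10[of "case_nat True x" q] by (simp add: transfer_eq)
next
  case (4 q)
  have "case_nat True x \<in> Rset (Suc q)" using 4 by (auto simp: Rset_def less_Suc_eq_0_disj)
  then show ?thesis
    using 4 assms eig_sum[of \<delta> q] jacobian_Rset[of "case_nat True x" "Suc q"]
      jacobian_01[of "case_nat False x" q] by (simp add: transfer_eq)
qed

lemma ln_jacobian:
  assumes "1 < \<delta>" "\<delta> < \<gamma>"
    and ne: "x \<notin> {zeros, ones, case_nat True zeros, case_nat False ones}"
  shows "ln (jacobian \<gamma> \<delta> x) =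
    hofbauer \<gamma> \<delta> x + ln (eigfun \<gamma> \<delta> x) - ln (eigfun \<gamma> \<delta> (shift x))"
proof -
  have x: "x = case_nat (x 0) (shift x)" by (auto simp: shift_def fun_eq_iff split: nat.splits)
  note pos = eig_pos less_imp_neq[OF eig_pos, symmetric]
  have lnJ: "ln ((real (Suc q) / (real (Suc q) - 1)) powr (- a) * (eig a (Suc q) / eig a q))
    = - a * ln (real (Suc q) / (real (Suc q) - 1)) + ln (eig a (Suc q)) - ln (eig a q)"
    if "q \<ge> 1" for a q
    using that pos[of a q] pos[of a "Suc q"] by (simp add: ln_mult ln_div ln_powr)
  show ?thesis
  proof (cases "shift x" rule: omega_cases)
    case 1
    have "case_nat False zeros = zeros" by (auto simp: fun_eq_iff split: nat.splits)
    with 1 x ne show ?thesis by (cases "x 0") auto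
  next
    case 2
    have "case_nat True ones = ones" by (auto simp: fun_eq_iff split: nat.splits)
    with 2 x ne show ?thesis by (cases "x 0") auto
  next
    case (3 q)
    have s0: "\<not> shift x 0" using 3 by (auto simp: Lset_def)
    show ?thesis
    proof (cases "x 0")
      case True
      have "x \<in> Rset 1" using True s0 by (auto simp: Rset_def shift_def)
      then have "block x = 1" by (rule block_Rset) simp
      then show ?thesis
        using True 3 s0 ne assms pos[of \<gamma> q] pos[of \<delta> 1] block_Lset[OF 3(2,1)]
        by (simp add: jacobian_10[OF True 3(2,1)] hofbauer_def eigfun_def eig_1[symmetric] ln_div)
    next
      case False
      have L: "x \<in> Lset (Suc q)" using False 3 by (subst x) (auto simp: Lset_def less_Suc_eq_0_disj)
      then have "block x = Suc q" by (rule block_Lset) simp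
      then show ?thesis
        using False 3 s0 ne block_Lset[OF 3(2,1)] lnJ[OF 3(1), of \<gamma>] jacobian_Lset[OF L]
        by (simp add: hofbauer_def eigfun_def)
    qed
  next
    case (4 q)
    have s0: "shift x 0" using 4 by (auto simp: Rset_def)
    show ?thesis
    proof (cases "x 0")
      case False
      have "x \<in> Lset 1" using False s0 by (auto simp: Lset_def shift_def)
      then have "block x = 1" by (rule block_Lset) simp
      then show ?thesis
        using False 4 s0 ne assms pos[of \<delta> q] pos[of \<gamma> 1] block_Rset[OF 4(2,1)]
        by (simp add: jacobian_01[OF False 4(2,1)] hofbauer_def eigfun_def eig_1[symmetric] ln_div)
    next
      case True
      have R: "x \<in> Rset (Suc q)" using True 4 by (subst x) (auto simp: Rset_def less_Suc_eq_0_disj)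
      then have "block x = Suc q" by (rule block_Rset) simp
      then show ?thesis
        using True 4 s0 ne block_Rset[OF 4(2,1)] lnJ[OF 4(1), of \<delta>] jacobian_Rset[OF R]
        by (simp add: hofbauer_def eigfun_def)
    qed
  qed
qed

end

theory Submission
  imports Defs
begin

text \<open>Both limits are limits of constant sequences. The points \<open>0\<^sup>\<infinity>\<close> and \<open>1\<^sup>\<infinity>\<close> are fixed by the
  shift, and their second preimages \<open>10\<^sup>\<infinity>\<close> and \<open>01\<^sup>\<infinity>\<close> carry no mass: the extended Jacobian is
  1 at the fixed point and 0 at the other preimage. A walk that runs backwards with transition
  probabilities \<open>J\<close> therefore never leaves a fixed point, so the Gibbs measures with these
  boundary conditions are the Dirac masses at \<open>0\<^sup>\<infinity>\<close> and \<open>1\<^sup>\<infinity>\<close> for every \<open>q\<close>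
  (\<open>gibbs_constant\<close>). Of the two points only \<open>0\<^sup>\<infinity>\<close> lies in the cylinder of sequences that
  begin with 0.\<close>

lemma case_nat_constant: "case_nat b (\<lambda>_. b) = (\<lambda>_. b)"
  by (auto simp: fun_eq_iff split: nat.splits)

lemma shift_constant: "(shift ^^ q) (\<lambda>_. b) = (\<lambda>_. b)"
  by (induction q) (simp_all add: shift_def)

lemma transfer_jacobian_constant:
  "transfer (jacobian \<gamma> \<delta>) \<psi> (\<lambda>_. b) = \<psi> (\<lambda>_. b)"
  by (cases b) (simp_all add: transfer_eq case_nat_constant jacobian_exceptional)

lemma gibbs_constant: "gibbs \<gamma> \<delta> q (\<lambda>_. b) F = indicator F (\<lambda>_. b)"
proof -
  have "(transfer (jacobian \<gamma> \<delta>) ^^ q) \<psi> (\<lambda>_. b) = \<psi> (\<lambda>_. b)" for \<psi>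
    by (induction q) (simp_all add: transfer_jacobian_constant)
  then show ?thesis
    by (simp add: gibbs_def shift_constant)
qed

theorem proposition27:
  fixes \<gamma> \<delta> :: real
  assumes "1 < \<delta>" and "\<delta> < \<gamma>"
  shows "(\<lambda>q. gibbs \<gamma> \<delta> q zeros {x. x 0 = False}) \<longlonglongrightarrow> 1
       \<and> (\<lambda>q. gibbs \<gamma> \<delta> q ones {x. x 0 = False}) \<longlonglongrightarrow> 0"
  by (simp add: gibbs_constant)

end
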